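(* Let $m$ be a positive integer with $m>\lceil d_\epsilon\rceil+\lceil\tilde d_{\tilde\epsilon}\rceil$. Then the nodes $\xi^{(m)}_0,\ldots,\xi^{(m)}_m$ satisfy the inequalities $$\frac{\pi\bigl(\hat l+\frac{\epsilon_-+\tilde\epsilon_-}{2}\bigr)}{m-d_\epsilon-\tilde d_{\tilde\epsilon}+\kappa_-}\leq\xi^{(m)}_{\hat l}\leq\frac{\pi\bigl(\hat l+\frac{\epsilon_-+\tilde\epsilon_-}{2}\bigr)}{m-d_\epsilon-\tilde d_{\tilde\epsilon}+\kappa_+}\qquad(0\leq\hat l\leq m)$$ and $$\frac{\pi(\hat k-\hat l)}{m-d_\epsilon-\tilde d_{\tilde\epsilon}+\kappa_-}\leq\xi^{(m)}_{\hat k}-\xi^{(m)}_{\hat l}\leq\frac{\pi(\hat k-\hat l)}{m-d_\epsilon-\tilde d_{\tilde\epsilon}+\kappa_+}\qquad(0\leq\hat l<\hat k\leq m),$$ where $$\kappa_\pm:=\frac12\sum_{1\leq r\leq d}\left(\frac{1-|\alpha_r|}{1+|\alpha_r|}\right)^{\pm1}+\frac12\sum_{1\leq r\leq\tilde d}\left(\frac{1-|\tilde\alpha_r|}{1+|\tilde\alpha_r|}\right)^{\pm1}.$$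
   Context: **Parameters.** Fix nonnegative integers $d,\tilde d$, signs $\epsilon_\pm,\tilde\epsilon_\pm\in\{0,1\}$, and parameters $\alpha_1,\ldots,\alpha_d$ and $\tilde\alpha_1,\ldots,\tilde\alpha_{\tilde d}$ with $0<|\alpha_r|<1$, $0<|\tilde\alpha_r|<1$, where possible complex parameters among the $\alpha_r$ occur in complex conjugate pairs, and likewise for the $\tilde\alpha_r$. Put $d_\epsilon:=\frac12(d-\epsilon_+-\epsilon_-)$ and $\tilde d_{\tilde\epsilon}:=\frac12(\tilde d-\tilde\epsilon_+-\tilde\epsilon_-)$. **Nodes.** For $|\alpha|<1$ let $u_\alpha(x):=\frac{1-\alpha^2}{1+2\alpha\cos(x)+\alpha^2}$. For a positive integer $m>\lceil d_\epsilon\rceil+\lceil\tilde d_{\tilde\epsilon}\rceil$ and $\hat l\in\{0,\ldots,m\}$, $\xi^{(m)}_{\hat l}$ denotes the unique real solution $\xi$ of $$2(m-d_\epsilon-\tilde d_{\tilde\epsilon})\xi+\sum_{1\leq r\leq d}\int_0^\xi u_{\alpha_r}(x)dx+\sum_{1\leq r\leq\tilde d}\int_0^\xi u_{\tilde\alpha_r}(x)dx=\pi(2\hat l+\epsilon_-+\tilde\epsilon_-).$$ One has $0\leq\xi^{(m)}_0<\xi^{(m)}_1<\cdots<\xi^{(m)}_m\leq\pi$. *)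

theory Defs
  imports "HOL-Analysis.Analysis"
begin

text \<open>
  The index set of a parameter family \<open>\<alpha>\<close> of length \<open>d\<close> is \<open>{1..d}\<close>; values outside are irrelevant.
  Conjugate pairs are counted with multiplicity: every non-real value occurs exactly as often
  as its complex conjugate.
\<close>

definition conjugate_pairs :: "nat \<Rightarrow> (nat \<Rightarrow> complex) \<Rightarrow> bool" where
  "conjugate_pairs d \<alpha> \<longleftrightarrow>
     (\<forall>z. z \<notin> \<real> \<longrightarrow> card {r \<in> {1..d}. \<alpha> r = z} = card {r \<in> {1..d}. \<alpha> r = cnj z})"

definition admissible :: "nat \<Rightarrow> (nat \<Rightarrow> complex) \<Rightarrow> bool" where
  "admissible d \<alpha> \<longleftrightarrow>
     (\<forall>r\<in>{1..d}. 0 < cmod (\<alpha> r) \<and> cmod (\<alpha> r) < 1) \<and> conjugate_pairs d \<alpha>"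

definition d_eps :: "nat \<Rightarrow> nat \<Rightarrow> nat \<Rightarrow> real" where
  "d_eps d ep em = (real d - real ep - real em) / 2"

definition u_alpha :: "complex \<Rightarrow> real \<Rightarrow> complex" where
  "u_alpha \<alpha> x = (1 - \<alpha>\<^sup>2) / (1 + 2 * \<alpha> * complex_of_real (cos x) + \<alpha>\<^sup>2)"

text \<open>
  The equation is one between complex numbers, as single summands need not be real when some
  parameters are not. The interval integral is oriented, so negative \<open>\<xi>\<close> is covered, too.
\<close>

definition node_equation ::
  "nat \<Rightarrow> nat \<Rightarrow> nat \<Rightarrow> (nat \<Rightarrow> complex) \<Rightarrow> nat \<Rightarrow> nat \<Rightarrow> nat \<Rightarrow> (nat \<Rightarrow> complex) \<Rightarrow>
   nat \<Rightarrow> nat \<Rightarrow> real \<Rightarrow> bool" where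
  "node_equation d ep em \<alpha> d' ep' em' \<alpha>' m l \<xi> \<longleftrightarrow>
     complex_of_real (2 * (real m - d_eps d ep em - d_eps d' ep' em') * \<xi>)
       + (\<Sum>r=1..d. LBINT x=ereal 0..ereal \<xi>. u_alpha (\<alpha> r) x)
       + (\<Sum>r=1..d'. LBINT x=ereal 0..ereal \<xi>. u_alpha (\<alpha>' r) x)
     = complex_of_real (pi * (2 * real l + real em + real em'))"

definition node ::
  "nat \<Rightarrow> nat \<Rightarrow> nat \<Rightarrow> (nat \<Rightarrow> complex) \<Rightarrow> nat \<Rightarrow> nat \<Rightarrow> nat \<Rightarrow> (nat \<Rightarrow> complex) \<Rightarrow>
   nat \<Rightarrow> nat \<Rightarrow> real" where
  "node d ep em \<alpha> d' ep' em' \<alpha>' m l = (THE \<xi>. node_equation d ep em \<alpha> d' ep' em' \<alpha>' m l \<xi>)"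

text \<open>The exponent \<open>s\<close> is \<open>1\<close> for \<open>\<kappa>\<^sub>+\<close> and \<open>-1\<close> for \<open>\<kappa>\<^sub>-\<close>.\<close>

definition kappa :: "int \<Rightarrow> nat \<Rightarrow> (nat \<Rightarrow> complex) \<Rightarrow> nat \<Rightarrow> (nat \<Rightarrow> complex) \<Rightarrow> real" where
  "kappa s d \<alpha> d' \<alpha>' =
     1/2 * (\<Sum>r=1..d. ((1 - cmod (\<alpha> r)) / (1 + cmod (\<alpha> r))) powi s)
   + 1/2 * (\<Sum>r=1..d'. ((1 - cmod (\<alpha>' r)) / (1 + cmod (\<alpha>' r))) powi s)"

end

(* With z = alpha e^(ix) and w = alpha e^(-ix), u_alpha is the average of the Moebius images
   (1 - z) / (1 + z) and (1 - w) / (1 + w), whose real parts on the disc of radius |alpha| lie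
   between (1 - |alpha|) / (1 + |alpha|) and its inverse.  The conjugate pairing makes the left-hand
   side of the node equation real, so that it is a real function of xi vanishing at 0 whose difference
   quotients lie between 2 (M + kappa_+) and 2 (M + kappa_-). *)

theory Submission
  imports Defs "HOL-Library.Multiset"
begin

section \<open>Moebius images of discs and pointwise bounds for \<open>u_alpha\<close>\<close>

lemma Re_moebius_bounds:
  assumes "cmod z \<le> \<rho>" "\<rho> < 1"
  shows "(1 - \<rho>) / (1 + \<rho>) \<le> Re ((1 - z) / (1 + z))"
    and "Re ((1 - z) / (1 + z)) \<le> (1 + \<rho>) / (1 - \<rho>)"
proof -
  define N where "N = (cmod z)\<^sup>2"
  define D where "D = (cmod (1 + z))\<^sup>2"
  have r0: "0 \<le> \<rho>" using assms norm_ge_zero order_trans by blast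
  have N: "N \<le> \<rho>\<^sup>2" unfolding N_def by (rule power_mono) (use assms in auto)
  have D1: "D \<le> (1 + \<rho>)\<^sup>2"
    unfolding D_def by (rule power_mono) (use norm_triangle_ineq[of 1 z] assms in auto)
  have D2: "(1 - \<rho>)\<^sup>2 \<le> D"
    unfolding D_def by (rule power_mono) (use norm_diff_ineq[of 1 z] assms in auto)
  have Dpos: "0 < D" using D2 assms by (smt (verit) zero_less_power)
  \<comment> \<open>This is the Poisson kernel form of the real part; it remains to compare
    \<open>1 - N\<close> with \<open>D\<close>.\<close>
  have re: "Re ((1 - z) / (1 + z)) = (1 - N) / D"
    unfolding N_def D_def cmod_power2
    by (simp add: Re_divide power2_eq_square algebra_simps)
  have "(1 - \<rho>) * D \<le> (1 + \<rho>) * (1 - N)"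
  proof -
    have "(1 - \<rho>) * D \<le> (1 - \<rho>) * (1 + \<rho>)\<^sup>2"
      using D1 assms by (intro mult_left_mono) auto
    also have "\<dots> = (1 + \<rho>) * (1 - \<rho>\<^sup>2)" by (simp add: power2_eq_square algebra_simps)
    also have "\<dots> \<le> (1 + \<rho>) * (1 - N)"
      using N r0 by (intro mult_left_mono) auto
    finally show ?thesis .
  qed
  then show "(1 - \<rho>) / (1 + \<rho>) \<le> Re ((1 - z) / (1 + z))"
    unfolding re using r0 Dpos by (simp add: divide_simps mult.commute)
  \<comment> \<open>Bounding \<open>N\<close> and \<open>D\<close> separately by \<rho> would only
    give 1 / (1 - \<rho>)^2. With t = |z| itself, D >= (1 - t)^2 lets a factor 1 - t cancel against
    1 - t^2, and (1 + t) / (1 - t) increases in t.\<close>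
  have "(1 - N) * (1 - \<rho>) \<le> (1 + \<rho>) * D"
  proof -
    define t where "t = cmod z"
    have t: "0 \<le> t" "t \<le> \<rho>" "N = t\<^sup>2" using assms by (auto simp: t_def N_def)
    have "(1 - t)\<^sup>2 \<le> D"
      unfolding D_def t_def
      by (rule power_mono) (use norm_diff_ineq[of 1 z] assms in auto)
    moreover have "(1 + t) * (1 - \<rho>) \<le> (1 + \<rho>) * (1 - t)"
      using t by (simp add: algebra_simps)
    then have "(1 - t) * ((1 + t) * (1 - \<rho>)) \<le> (1 - t) * ((1 + \<rho>) * (1 - t))"
      using t assms by (intro mult_left_mono) auto
    then have "(1 - N) * (1 - \<rho>) \<le> (1 + \<rho>) * (1 - t)\<^sup>2"
      unfolding t by (simp add: power2_eq_square algebra_simps)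
    ultimately show ?thesis
      using r0 mult_left_mono[of "(1 - t)\<^sup>2" D "1 + \<rho>"] by linarith
  qed
  then show "Re ((1 - z) / (1 + z)) \<le> (1 + \<rho>) / (1 - \<rho>)"
    unfolding re using assms Dpos by (simp add: divide_simps mult.commute)
qed

lemma one_plus_nonzero: "1 + z \<noteq> 0" if "cmod z < 1"
  using that by (metis add_eq_0_iff norm_minus_cancel norm_one order_less_irrefl)

text \<open>Factoring through e^(ix) and e^(-ix) makes the zeros visible, all with |a| = 1, and
  prepares the partial fractions of \<open>u_alpha\<close>.\<close>

lemma u_alpha_denominator:
  "1 + 2 * a * complex_of_real (cos x) + a\<^sup>2 = (1 + a * cis x) * (1 + a * cis (- x))"
proof -
  have "cis x * cis (- x) = 1" by (simp add: cis_mult)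
  moreover have "cis x + cis (- x) = 2 * complex_of_real (cos x)"
    by (simp add: complex_eq_iff)
  ultimately show ?thesis by algebra
qed

lemma u_alpha_denominator_nonzero:
  assumes "cmod a < 1"
  shows "1 + 2 * a * complex_of_real (cos x) + a\<^sup>2 \<noteq> 0"
  unfolding u_alpha_denominator using assms by (simp add: one_plus_nonzero norm_mult)

lemma u_alpha_moebius:
  assumes "cmod a < 1"
  shows "u_alpha a x = ((1 - a * cis x) / (1 + a * cis x) + (1 - a * cis (- x)) / (1 + a * cis (- x))) / 2"
proof -
  \<comment> \<open>With z = a e^(ix) and w = a e^(-ix), the mixed terms cancel: (1 - z)(1 + w) + (1
    - w)(1 + z) = 2 (1 - zw), and zw = a^2.\<close>
  have "cis x * cis (- x) = 1" by (simp add: cis_mult)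
  then have "(1 - a * cis x) * (1 + a * cis (- x)) + (1 - a * cis (- x)) * (1 + a * cis x)
      = 2 * (1 - a\<^sup>2)"
    by algebra
  moreover have "1 + a * cis x \<noteq> 0" "1 + a * cis (- x) \<noteq> 0"
    using assms by (simp_all add: one_plus_nonzero norm_mult)
  ultimately show ?thesis
    unfolding u_alpha_def u_alpha_denominator by (simp add: add_frac_eq del: right_diff_distrib_numeral)
qed

lemma Re_u_alpha_bounds:
  assumes "cmod a < 1"
  shows "(1 - cmod a) / (1 + cmod a) \<le> Re (u_alpha a x)"
    and "Re (u_alpha a x) \<le> (1 + cmod a) / (1 - cmod a)"
proof -
  have moebius: "(1 - cmod a) / (1 + cmod a) \<le> Re ((1 - a * cis y) / (1 + a * cis y))"
      "Re ((1 - a * cis y) / (1 + a * cis y)) \<le> (1 + cmod a) / (1 - cmod a)" for y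
    using Re_moebius_bounds[of "a * cis y" "cmod a"] assms by (simp_all add: norm_mult)
  have average: "p \<le> u \<Longrightarrow> p \<le> v \<Longrightarrow> p \<le> (u + v) / 2"
      "u \<le> q \<Longrightarrow> v \<le> q \<Longrightarrow> (u + v) / 2 \<le> q" for p q u v :: real
    by auto
  have mean: "Re ((v + w) / 2) = (Re v + Re w) / 2" for v w by simp
  show "(1 - cmod a) / (1 + cmod a) \<le> Re (u_alpha a x)"
      "Re (u_alpha a x) \<le> (1 + cmod a) / (1 - cmod a)"
    unfolding u_alpha_moebius[OF assms] mean
    by (rule average(1)[OF moebius(1) moebius(1)] average(2)[OF moebius(2) moebius(2)])+
qed

section \<open>Integrals of \<open>u_alpha\<close>: derivative, and reality of their sums\<close>

lemma u_alpha_integral_has_derivative: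
  assumes "cmod a < 1"
  shows "((\<lambda>t. LBINT x=ereal 0..ereal t. u_alpha a x) has_vector_derivative u_alpha a x) (at x)"
proof -
  \<comment> \<open>The interval [-B, B] contains the base point 0 and has x in its interior, so the
    derivative within it is a two-sided one, for negative x as well.\<close>
  define B where "B = \<bar>x\<bar> + 1"
  have "continuous_on {- B..B} (u_alpha a)"
    unfolding u_alpha_def
    by (intro continuous_intros) (use u_alpha_denominator_nonzero[OF assms] in auto)
  then have "((\<lambda>t. LBINT x=ereal 0..ereal t. u_alpha a x) has_vector_derivative u_alpha a x)
      (at x within {- B..B})"
    using interval_integral_FTC2[of "- B" 0 B "u_alpha a" x] by (auto simp: B_def)
  moreover have "x \<in> interior {- B..B}" by (auto simp: B_def)
  ultimately show ?thesis by (metis at_within_interior)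
qed

lemma cnj_u_alpha_integral:
  "cnj (LBINT x=ereal 0..ereal t. u_alpha a x) = (LBINT x=ereal 0..ereal t. u_alpha (cnj a) x)"
proof -
  \<comment> \<open>For real x, \<open>u_alpha a x\<close> is a rational expression in a with real
    coefficients.\<close>
  have "cnj (u_alpha a x) = u_alpha (cnj a) x" for x
    by (simp add: u_alpha_def)
  then show ?thesis
    by (simp add: interval_lebesgue_integral_def set_lebesgue_integral_def
        flip: Bochner_Integration.integral_cnj)
qed

text \<open>Conjugation preserves the multiset of parameters: non-real values by the pairing, real
  ones because they are fixed. Comparing multisets avoids choosing an involution of the
  indices.\<close>

lemma conjugate_pairs_sum_cnj:
  fixes f :: "complex \<Rightarrow> 'a::comm_monoid_add"
  assumes "conjugate_pairs d \<alpha>"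
  shows "(\<Sum>r=1..d. f (cnj (\<alpha> r))) = (\<Sum>r=1..d. f (\<alpha> r))"
proof -
  have "image_mset (\<lambda>r. cnj (\<alpha> r)) (mset_set {1..d}) = image_mset \<alpha> (mset_set {1..d})"
  proof (rule multiset_eqI)
    fix z
    have "card {r \<in> {1..d}. \<alpha> r = cnj z} = card {r \<in> {1..d}. \<alpha> r = z}"
    proof (cases "z \<in> \<real>")
      case True
      then show ?thesis by (simp add: Reals_cnj_iff)
    next
      case False
      then show ?thesis using assms unfolding conjugate_pairs_def by metis
    qed
    moreover have "cnj (\<alpha> r) = z \<longleftrightarrow> \<alpha> r = cnj z" for r by auto
    moreover have "count (image_mset g (mset_set {1..d})) z = card {r \<in> {1..d}. g r = z}" for g :: "nat \<Rightarrow> complex"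
      by (simp add: count_image_mset vimage_def Int_def conj_commute)
    ultimately show "count (image_mset (\<lambda>r. cnj (\<alpha> r)) (mset_set {1..d})) z
        = count (image_mset \<alpha> (mset_set {1..d})) z"
      by simp
  qed
  then have "sum_mset (image_mset f (image_mset (\<lambda>r. cnj (\<alpha> r)) (mset_set {1..d})))
      = sum_mset (image_mset f (image_mset \<alpha> (mset_set {1..d})))"
    by simp
  then show ?thesis
    by (simp add: image_mset.compositionality comp_def sum_unfold_sum_mset)
qed

text \<open>Conjugating the sum replaces each parameter by its conjugate, which leaves the sum
  unchanged. This turns the complex node equation into a real one.\<close>

lemma sum_u_alpha_integral_real:
  assumes "conjugate_pairs d \<alpha>"
  shows "(\<Sum>r=1..d. LBINT x=ereal 0..ereal t. u_alpha (\<alpha> r) x)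
    = complex_of_real (\<Sum>r=1..d. Re (LBINT x=ereal 0..ereal t. u_alpha (\<alpha> r) x))" (is "?S = _")
proof -
  have "cnj ?S = ?S"
    using conjugate_pairs_sum_cnj[OF assms, of "\<lambda>a. LBINT x=ereal 0..ereal t. u_alpha a x"]
    by (simp add: cnj_u_alpha_integral)
  then have "?S = complex_of_real (Re ?S)"
    by (metis Reals_cnj_iff of_real_Re)
  then show ?thesis by simp
qed

lemma sum_u_alpha_integral_derivative:
  assumes "admissible d \<alpha>"
  shows "((\<lambda>t. \<Sum>r=1..d. Re (LBINT x=ereal 0..ereal t. u_alpha (\<alpha> r) x))
    has_real_derivative (\<Sum>r=1..d. Re (u_alpha (\<alpha> r) x))) (at x)"
  unfolding has_real_derivative_iff_has_vector_derivative
proof (rule has_vector_derivative_sum)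
  fix r assume "r \<in> {1..d}"
  then have "cmod (\<alpha> r) < 1" using assms by (simp add: admissible_def)
  then show "((\<lambda>t. Re (LBINT x=ereal 0..ereal t. u_alpha (\<alpha> r) x))
      has_vector_derivative Re (u_alpha (\<alpha> r) x)) (at x)"
    by (intro bounded_linear.has_vector_derivative[OF bounded_linear_Re] u_alpha_integral_has_derivative)
qed

lemma sum_Re_u_alpha_bounds:
  assumes "admissible d \<alpha>"
  shows "(\<Sum>r=1..d. ((1 - cmod (\<alpha> r)) / (1 + cmod (\<alpha> r))) powi 1) \<le> (\<Sum>r=1..d. Re (u_alpha (\<alpha> r) x))"
    and "(\<Sum>r=1..d. Re (u_alpha (\<alpha> r) x)) \<le> (\<Sum>r=1..d. ((1 - cmod (\<alpha> r)) / (1 + cmod (\<alpha> r))) powi (-1))"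
  using assms Re_u_alpha_bounds unfolding admissible_def
  by (auto intro!: sum_mono simp: power_int_minus)

section \<open>Real functions whose derivative has a positive lower bound\<close>

lemma increment_bounds_of_derivative_bounds:
  fixes F F' :: "real \<Rightarrow> real"
  assumes "\<And>x. (F has_real_derivative F' x) (at x)"
    and "\<And>x. p \<le> F' x" "\<And>x. F' x \<le> q"
    and "0 < p" "F x \<le> F y"
  shows "(F y - F x) / q \<le> y - x" and "y - x \<le> (F y - F x) / p"
proof -
  have mvt: "\<exists>z. F b - F a = (b - a) * F' z" if "a < b" for a b
    using MVT2[OF that, of F F'] assms(1) by blast
  \<comment> \<open>For nodes the values of \<open>F\<close> are known in advance but not the order
    of the points, so the order is recovered from \<open>F x \<le> F y\<close> and the positive
    slope.\<close>
  have "x \<le> y"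
  proof (rule ccontr)
    assume "\<not> x \<le> y"
    then obtain z where "F x - F y = (x - y) * F' z" using mvt[of y x] by auto
    moreover have "0 < (x - y) * F' z"
      using \<open>\<not> x \<le> y\<close> assms(2)[of z] assms(4) by (intro mult_pos_pos) auto
    ultimately show False using assms(5) by linarith
  qed
  then obtain z where z: "F y - F x = (y - x) * F' z"
    using mvt[of x y] by (cases "x = y") auto
  have "p \<le> F' z" "F' z \<le> q" "0 < q"
    using assms(2)[of z] assms(3)[of z] assms(4) by auto
  moreover have "(y - x) * p \<le> (y - x) * F' z" "(y - x) * F' z \<le> (y - x) * q"
    using \<open>x \<le> y\<close> calculation by (auto intro!: mult_left_mono)
  ultimately show "(F y - F x) / q \<le> y - x" "y - x \<le> (F y - F x) / p"
    unfolding z using assms(4) by (simp_all add: pos_divide_le_eq pos_le_divide_eq)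
qed

lemma derivative_bounded_below_ex1:
  fixes F F' :: "real \<Rightarrow> real"
  assumes deriv: "\<And>x. (F has_real_derivative F' x) (at x)"
    and lb: "\<And>x. p \<le> F' x" and "0 < p" "F 0 = 0" "0 \<le> c"
  shows "\<exists>!x. F x = c"
proof (rule ex_ex1I)
  \<comment> \<open>To the right of 0 the graph of \<open>F\<close> stays above the line of slope p
    through the origin, which reaches height c at c / p. The case c = 0 is separate because the mean
    value theorem needs a nondegenerate interval.\<close>
  have "c \<le> F (c / p)"
  proof (cases "c = 0")
    case False
    then have "0 < c / p" using assms by simp
    then obtain z where "F (c / p) - F 0 = (c / p - 0) * F' z"
      using MVT2[of 0 "c / p" F F'] deriv by blast
    moreover have "c / p * p \<le> c / p * F' z"
      using lb assms by (intro mult_left_mono) auto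
    ultimately show ?thesis using assms by simp
  qed (use assms in simp)
  moreover have "continuous_on {0..c / p} F"
    using deriv by (meson DERIV_isCont continuous_at_imp_continuous_on)
  ultimately show "\<exists>x. F x = c"
    using IVT'[of F 0 c "c / p"] assms by auto
next
  fix x y assume "F x = c" "F y = c"
  moreover have "strict_mono F"
    using DERIV_pos_imp_increasing[of _ _ F] deriv lb \<open>0 < p\<close>
    by (intro strict_monoI) (meson order_less_le_trans)
  ultimately show "x = y" by (metis strict_mono_eq)
qed

theorem mainTheorem7:
  fixes d d' ep em ep' em' m :: nat
    and \<alpha> \<alpha>' :: "nat \<Rightarrow> complex"
  assumes "ep \<in> {0, 1}" and "em \<in> {0, 1}" and "ep' \<in> {0, 1}" and "em' \<in> {0, 1}"
    and "admissible d \<alpha>" and "admissible d' \<alpha>'"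
    and "m > 0"
    and "int m > \<lceil>d_eps d ep em\<rceil> + \<lceil>d_eps d' ep' em'\<rceil>"
  defines "\<xi> \<equiv> node d ep em \<alpha> d' ep' em' \<alpha>' m"
    and "M \<equiv> real m - d_eps d ep em - d_eps d' ep' em'"
    and "kp \<equiv> kappa 1 d \<alpha> d' \<alpha>'"
    and "km \<equiv> kappa (-1) d \<alpha> d' \<alpha>'"
  shows "(\<forall>l\<le>m.
            pi * (real l + (real em + real em') / 2) / (M + km) \<le> \<xi> l
          \<and> \<xi> l \<le> pi * (real l + (real em + real em') / 2) / (M + kp))
       \<and> (\<forall>l k. l < k \<and> k \<le> m \<longrightarrow>
            pi * (real k - real l) / (M + km) \<le> \<xi> k - \<xi> l
          \<and> \<xi> k - \<xi> l \<le> pi * (real k - real l) / (M + kp))"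
proof -
  define S where "S = (\<lambda>d \<alpha> t. \<Sum>r=1..d. Re (LBINT x=ereal 0..ereal t. u_alpha (\<alpha> (r::nat)) x))"
  define s where "s = (\<lambda>d \<alpha> x. \<Sum>r=1..d. Re (u_alpha (\<alpha> (r::nat)) x))"
  \<comment> \<open>\<open>F\<close> is the real part of the left-hand side of the node equation,
    and \<open>c l\<close> below is its right-hand side.\<close>
  define F where "F = (\<lambda>t. 2 * M * t + S d \<alpha> t + S d' \<alpha>' t)"
  define F' where "F' = (\<lambda>x. 2 * M + s d \<alpha> x + s d' \<alpha>' x)"
  define c where "c = (\<lambda>l::nat. pi * (2 * real l + real em + real em'))"
  have "0 < M"
    using assms(8) le_of_int_ceiling[of "d_eps d ep em"] le_of_int_ceiling[of "d_eps d' ep' em'"]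
    unfolding M_def by linarith
  moreover have "0 \<le> (\<Sum>r=1..n. ((1 - cmod (a r)) / (1 + cmod (a r))) powi 1)"
    if "admissible n a" for n a
    using that unfolding admissible_def by (intro sum_nonneg) (simp add: less_imp_le)
  then have "0 \<le> kp"
    using assms(5,6) unfolding kp_def kappa_def by simp
  ultimately have pos: "0 < 2 * (M + kp)" by simp
  have deriv: "(F has_real_derivative F' x) (at x)" for x
    unfolding F_def F'_def S_def s_def
    by (rule derivative_eq_intros sum_u_alpha_integral_derivative assms refl)+ simp
  \<comment> \<open>The factor 1/2 in \<open>kappa\<close> is absorbed by the 2. The larger slope
    bound, with \<open>km\<close>, yields the lower bounds for nodes and gaps.\<close>
  have lower: "2 * (M + kp) \<le> F' x" and upper: "F' x \<le> 2 * (M + km)" for x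
    using sum_Re_u_alpha_bounds[OF assms(5), of x] sum_Re_u_alpha_bounds[OF assms(6), of x]
    unfolding F'_def s_def kp_def km_def kappa_def by argo+
  have F0: "F 0 = 0" by (simp add: F_def S_def)
  have eq: "node_equation d ep em \<alpha> d' ep' em' \<alpha>' m l t \<longleftrightarrow> F t = c l" for l t
  proof -
    have "conjugate_pairs d \<alpha>" "conjugate_pairs d' \<alpha>'"
      using assms(5,6) by (auto simp: admissible_def)
    then show ?thesis
      unfolding node_equation_def F_def S_def c_def M_def
      by (simp only: sum_u_alpha_integral_real flip: of_real_add) (simp only: of_real_eq_iff)
  qed
  \<comment> \<open>As \<open>node\<close> is a definite description, unique solvability must come
    first; it rests on \<open>c l\<close> being nonnegative.\<close>
  have node: "F (\<xi> l) = c l" for l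
  proof -
    have "\<exists>!t. F t = c l"
      by (rule derivative_bounded_below_ex1[OF deriv lower pos F0]) (simp add: c_def)
    then show ?thesis unfolding \<xi>_def node_def eq by (rule theI')
  qed
  note bounds = increment_bounds_of_derivative_bounds[OF deriv lower upper pos]
  have half: "2 * a / (2 * b) = a / b" for a b :: real by simp
  have "c l = 2 * (pi * (real l + (real em + real em') / 2))" for l
    by (simp add: c_def algebra_simps)
  moreover have "0 \<le> c l" for l by (simp add: c_def)
  \<comment> \<open>The increment of \<open>F\<close> is taken from 0, where it vanishes, to the
    node.\<close>
  ultimately have "pi * (real l + (real em + real em') / 2) / (M + km) \<le> \<xi> l
      \<and> \<xi> l \<le> pi * (real l + (real em + real em') / 2) / (M + kp)" for l
    using bounds[of 0 "\<xi> l"] unfolding F0 node by (simp only: half diff_zero)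
  moreover have "pi * (real k - real l) / (M + km) \<le> \<xi> k - \<xi> l
      \<and> \<xi> k - \<xi> l \<le> pi * (real k - real l) / (M + kp)" if "l < k" for l k
  proof -
    \<comment> \<open>Between two nodes the sign parameters cancel in the increment of
      \<open>F\<close>.\<close>
    have "c k - c l = 2 * (pi * (real k - real l))" by (simp add: c_def algebra_simps)
    moreover have "c l \<le> c k" using that by (simp add: c_def)
    ultimately show ?thesis
      using bounds[of "\<xi> l" "\<xi> k"] unfolding node by (simp only: half)
  qed
  ultimately show ?thesis by blast
qed

end
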